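(* Let $(M,\circ,e,\tilde{\mathcal{S}},u)$ be an $F$-manifold with a special family of connections $\tilde{\mathcal{S}}$ and a Legendre field $u$. The following facts hold: i) The Legendre transformation $\mathcal{L}_{u}(\tilde{\mathcal{S}})$ of $\tilde{\mathcal{S}}$ by $u$ is also special on $(M,\circ,e)$. ii) If one (equivalently, any) connection $\tilde{\nabla}\in\tilde{\mathcal{S}}$ satisfies $$V\circ R^{\tilde{\nabla}}_{Z,Y}X+Y\circ R^{\tilde{\nabla}}_{V,Z}X+Z\circ R^{\tilde{\nabla}}_{Y,V}X=0,\qquad\forall X,Y,Z,V\in\mathcal{X}(M),$$ then the same is true for any connection from $\mathcal{L}_{u}(\tilde{\mathcal{S}})$. iii) If $\tilde{\mathcal{S}}$ contains a flat connection, then so does $\mathcal{L}_{u}(\tilde{\mathcal{S}})$.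
   Context: Everything is in the smooth category; $\mathcal{X}(M)$ denotes the vector fields on the manifold $M$; $R^{\nabla}$ is the curvature of a connection $\nabla$, $R^{\nabla}_{X,Y}Z=\nabla_{X}\nabla_{Y}Z-\nabla_{Y}\nabla_{X}Z-\nabla_{[X,Y]}Z$; a connection is flat if its curvature vanishes. $F$-manifold: a triple $(M,\circ,e)$ where $M$ is a manifold and $\circ$ is a fiber-preserving commutative, associative, bilinear multiplication on $TM$ with unit field $e$, such that $L_{X\circ Y}(\circ)=X\circ L_{Y}(\circ)+Y\circ L_{X}(\circ)$ for all $X,Y\in\mathcal{X}(M)$, where $L_{Z}(\circ)(X,Y)=[Z,X\circ Y]-[Z,X]\circ Y-X\circ[Z,Y]$. A vector field $u$ is invertible if there is a vector field $u^{-1}$ with $u\circ u^{-1}=e$. Compatible connection: a connection $\nabla$ on $TM$ is compatible with $\circ$ if $\nabla_{X}(\circ)(Y,Z):=\nabla_{X}(Y\circ Z)-\nabla_{X}(Y)\circ Z-Y\circ\nabla_{X}(Z)$ is totally symmetric in $X,Y,Z$. Special family: a family of connections $\tilde{\mathcal{S}}$ on an $F$-manifold $(M,\circ,e)$ is special if $\tilde{\mathcal{S}}=\{\tilde{\nabla}^{V},\ V\in\mathcal{X}(M)\}$ where $\tilde{\nabla}^{V}_{X}(Y):=\tilde{\nabla}_{X}(Y)+V\circ X\circ Y$ and $\tilde{\nabla}$ is torsion-free and compatible with $\circ$. (The curvature condition in ii), if it holds for one connection of a special family, holds for all of them.) Legendre field: a vector field $u$ on $(M,\circ,e,\tilde{\mathcal{S}})$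 is a Legendre field if it is invertible and, for one (equivalently, any) $\tilde{\nabla}\in\tilde{\mathcal{S}}$, $\tilde{\nabla}_{X}(u)\circ Y=\tilde{\nabla}_{Y}(u)\circ X$ for all $X,Y\in\mathcal{X}(M)$. Legendre transformation: $\mathcal{L}_{u}(\tilde{\mathcal{S}})=\{\mathcal{L}_{u}(\tilde{\nabla}),\ \tilde{\nabla}\in\tilde{\mathcal{S}}\}$, where $\mathcal{L}_{u}(\tilde{\nabla})_{X}(Y)=u^{-1}\circ\tilde{\nabla}_{X}(u\circ Y)$. *)

theory Defs
  imports "HOL-Analysis.Analysis" "HOL-Library.Function_Algebras"
begin

section \<open>Smooth maps between open subsets of normed spaces\<close>

text \<open>
  \<open>S\<close> is meant to be open, so that \<^const>\<open>frechet_derivative\<close> at a point of \<open>S\<close>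
  only depends on the values of the map on \<open>S\<close>.
\<close>

primrec Ck_on :: "nat \<Rightarrow> ('b::real_normed_vector \<Rightarrow> 'c::real_normed_vector) \<Rightarrow> 'b set \<Rightarrow> bool" where
  "Ck_on 0 f S \<longleftrightarrow> continuous_on S f"
| "Ck_on (Suc k) f S \<longleftrightarrow>
     (\<forall>x\<in>S. f differentiable at x) \<and> (\<forall>v. Ck_on k (\<lambda>x. frechet_derivative f (at x) v) S)"

definition smooth_on :: "('b::real_normed_vector \<Rightarrow> 'c::real_normed_vector) \<Rightarrow> 'b set \<Rightarrow> bool" where
  "smooth_on f S \<longleftrightarrow> (\<forall>k. Ck_on k f S)"


section \<open>Smooth manifolds, tangent vectors and vector fields\<close>

text \<open>
  The manifold is \<open>topspace M\<close>. A chart is a pair of its domain and a map that is only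
  relevant on that domain. The atlas \<open>A\<close> need not be maximal.

  Tangent vectors at \<open>p\<close> are the derivations at \<open>p\<close> of the algebra of smooth functions.
  To represent functions, tangent vectors and vector fields uniquely by total functions, they
  take the value 0 outside their proper domain: a smooth function vanishes off \<open>topspace M\<close>,
  a tangent vector vanishes on non-smooth functions, and a vector field vanishes off
  \<open>topspace M\<close>. Addition, subtraction and \<open>0\<close> are the pointwise ones from
  \<^theory>\<open>HOL-Library.Function_Algebras\<close>.
\<close>

type_synonym 'a tangent_vector = "('a \<Rightarrow> real) \<Rightarrow> real"
type_synonym 'a vector_field = "'a \<Rightarrow> 'a tangent_vector"

locale smooth_manifold =
  fixes M :: "'a topology"
    and A :: "('a set \<times> ('a \<Rightarrow> 'b::euclidean_space)) set"
  assumes Hausdorff: "Hausdorff_space M"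
    and second_countable: "second_countable M"
    and charts_cover: "(\<Union>(U, \<phi>)\<in>A. U) = topspace M"
    and chart_domain_open: "(U, \<phi>) \<in> A \<Longrightarrow> openin M U"
    and chart_image_open: "(U, \<phi>) \<in> A \<Longrightarrow> open (\<phi> ` U)"
    and chart_homeomorphism:
      "(U, \<phi>) \<in> A \<Longrightarrow> homeomorphic_map (subtopology M U) (top_of_set (\<phi> ` U)) \<phi>"
    and charts_compatible:
      "(U, \<phi>) \<in> A \<Longrightarrow> (V, \<psi>) \<in> A \<Longrightarrow> smooth_on (\<psi> \<circ> inv_into U \<phi>) (\<phi> ` (U \<inter> V))"
begin

definition smooth_functions :: "('a \<Rightarrow> real) set" where
  "smooth_functions =
     {f. (\<forall>(U, \<phi>)\<in>A. smooth_on (f \<circ> inv_into U \<phi>) (\<phi> ` U)) \<and> (\<forall>p. p \<notin> topspace M \<longrightarrow> f p = 0)}"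

definition tangent_space :: "'a \<Rightarrow> 'a tangent_vector set" where
  "tangent_space p =
     {D. (\<forall>f\<in>smooth_functions. \<forall>g\<in>smooth_functions. D (f + g) = D f + D g) \<and>
         (\<forall>c. \<forall>f\<in>smooth_functions. D (\<lambda>q. c * f q) = c * D f) \<and>
         (\<forall>f\<in>smooth_functions. \<forall>g\<in>smooth_functions. D (f * g) = f p * D g + g p * D f) \<and>
         (\<forall>f. f \<notin> smooth_functions \<longrightarrow> D f = 0)}"

definition vector_fields :: "'a vector_field set" where
  "vector_fields =
     {X. (\<forall>p\<in>topspace M. X p \<in> tangent_space p) \<and>
         (\<forall>p. p \<notin> topspace M \<longrightarrow> X p = 0) \<and>
         (\<forall>f\<in>smooth_functions. (\<lambda>p. X p f) \<in> smooth_functions)}"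

definition vf_apply :: "'a vector_field \<Rightarrow> ('a \<Rightarrow> real) \<Rightarrow> ('a \<Rightarrow> real)" where
  "vf_apply X f = (\<lambda>p. X p f)"

definition vf_scale :: "('a \<Rightarrow> real) \<Rightarrow> 'a vector_field \<Rightarrow> 'a vector_field"  (infixr "\<cdot>" 75) where
  "f \<cdot> X = (\<lambda>p g. f p * X p g)"

definition lie_bracket :: "'a vector_field \<Rightarrow> 'a vector_field \<Rightarrow> 'a vector_field" where
  "lie_bracket X Y = (\<lambda>p f. X p (vf_apply Y f) - Y p (vf_apply X f))"


section \<open>Connections on the tangent bundle\<close>

text \<open>
  A connection is a map on pairs of vector fields; its value is fixed to be 0 when an argument
  is not a vector field, so that equality of connections is equality of functions.
\<close>

definition connection :: "('a vector_field \<Rightarrow> 'a vector_field \<Rightarrow> 'a vector_field) \<Rightarrow> bool" where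
  "connection D \<longleftrightarrow>
     (\<forall>X\<in>vector_fields. \<forall>Y\<in>vector_fields. D X Y \<in> vector_fields) \<and>
     (\<forall>X\<in>vector_fields. \<forall>Y\<in>vector_fields. \<forall>Z\<in>vector_fields. D (X + Y) Z = D X Z + D Y Z) \<and>
     (\<forall>f\<in>smooth_functions. \<forall>X\<in>vector_fields. \<forall>Y\<in>vector_fields. D (f \<cdot> X) Y = f \<cdot> D X Y) \<and>
     (\<forall>X\<in>vector_fields. \<forall>Y\<in>vector_fields. \<forall>Z\<in>vector_fields. D X (Y + Z) = D X Y + D X Z) \<and>
     (\<forall>f\<in>smooth_functions. \<forall>X\<in>vector_fields. \<forall>Y\<in>vector_fields.
        D X (f \<cdot> Y) = vf_apply X f \<cdot> Y + f \<cdot> D X Y) \<and>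
     (\<forall>X Y. X \<notin> vector_fields \<or> Y \<notin> vector_fields \<longrightarrow> D X Y = 0)"

definition torsion_free :: "('a vector_field \<Rightarrow> 'a vector_field \<Rightarrow> 'a vector_field) \<Rightarrow> bool" where
  "torsion_free D \<longleftrightarrow>
     (\<forall>X\<in>vector_fields. \<forall>Y\<in>vector_fields. D X Y - D Y X = lie_bracket X Y)"

definition curvature ::
  "('a vector_field \<Rightarrow> 'a vector_field \<Rightarrow> 'a vector_field) \<Rightarrow>
   'a vector_field \<Rightarrow> 'a vector_field \<Rightarrow> 'a vector_field \<Rightarrow> 'a vector_field" where
  "curvature D X Y Z = D X (D Y Z) - D Y (D X Z) - D (lie_bracket X Y) Z"

definition flat :: "('a vector_field \<Rightarrow> 'a vector_field \<Rightarrow> 'a vector_field) \<Rightarrow> bool" where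
  "flat D \<longleftrightarrow>
     (\<forall>X\<in>vector_fields. \<forall>Y\<in>vector_fields. \<forall>Z\<in>vector_fields. curvature D X Y Z = 0)"

end


section \<open>Multiplications on the tangent bundle\<close>

text \<open>
  \<open>mult p\<close> is the multiplication on the tangent space at \<open>p\<close>; linearity in the second argument
  follows from commutativity. Smoothness of the multiplication is expressed by
  \<open>mult_smooth\<close>: the product of vector fields is a vector field.
\<close>

locale tangent_multiplication = smooth_manifold M A
  for M :: "'a topology" and A :: "('a set \<times> ('a \<Rightarrow> 'b::euclidean_space)) set" +
  fixes mult :: "'a \<Rightarrow> 'a tangent_vector \<Rightarrow> 'a tangent_vector \<Rightarrow> 'a tangent_vector"
    and e :: "'a vector_field"
  assumes mult_closed:
      "p \<in> topspace M \<Longrightarrow> v \<in> tangent_space p \<Longrightarrow> w \<in> tangent_space p \<Longrightarrow>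
        mult p v w \<in> tangent_space p"
    and mult_add:
      "p \<in> topspace M \<Longrightarrow> v \<in> tangent_space p \<Longrightarrow> v' \<in> tangent_space p \<Longrightarrow>
        w \<in> tangent_space p \<Longrightarrow> mult p (v + v') w = mult p v w + mult p v' w"
    and mult_scale:
      "p \<in> topspace M \<Longrightarrow> v \<in> tangent_space p \<Longrightarrow> w \<in> tangent_space p \<Longrightarrow>
        mult p (\<lambda>f. c * v f) w = (\<lambda>f. c * mult p v w f)"
    and mult_commute:
      "p \<in> topspace M \<Longrightarrow> v \<in> tangent_space p \<Longrightarrow> w \<in> tangent_space p \<Longrightarrow>
        mult p v w = mult p w v"
    and mult_assoc:
      "p \<in> topspace M \<Longrightarrow> v \<in> tangent_space p \<Longrightarrow> w \<in> tangent_space p \<Longrightarrow>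
        z \<in> tangent_space p \<Longrightarrow> mult p (mult p v w) z = mult p v (mult p w z)"
    and mult_smooth:
      "X \<in> vector_fields \<Longrightarrow> Y \<in> vector_fields \<Longrightarrow>
        (\<lambda>p. if p \<in> topspace M then mult p (X p) (Y p) else 0) \<in> vector_fields"
    and unit_field: "e \<in> vector_fields"
    and mult_unit: "p \<in> topspace M \<Longrightarrow> v \<in> tangent_space p \<Longrightarrow> mult p (e p) v = v"
begin

definition vf_mult :: "'a vector_field \<Rightarrow> 'a vector_field \<Rightarrow> 'a vector_field"  (infixl "\<star>" 70) where
  "X \<star> Y = (\<lambda>p. if p \<in> topspace M then mult p (X p) (Y p) else 0)"

text \<open>\<open>lie_mult Z\<close> is the Lie derivative of the multiplication in the direction \<open>Z\<close>.\<close>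

definition lie_mult ::
  "'a vector_field \<Rightarrow> 'a vector_field \<Rightarrow> 'a vector_field \<Rightarrow> 'a vector_field" where
  "lie_mult Z X Y = lie_bracket Z (X \<star> Y) - lie_bracket Z X \<star> Y - X \<star> lie_bracket Z Y"

definition invertible_field :: "'a vector_field \<Rightarrow> bool" where
  "invertible_field u \<longleftrightarrow> u \<in> vector_fields \<and> (\<exists>v\<in>vector_fields. u \<star> v = e)"

definition inverse_field :: "'a vector_field \<Rightarrow> 'a vector_field" where
  "inverse_field u = (THE v. v \<in> vector_fields \<and> u \<star> v = e)"

text \<open>\<open>cov_mult D X\<close> is the covariant derivative of the multiplication in the direction \<open>X\<close>.\<close>

definition cov_mult ::
  "('a vector_field \<Rightarrow> 'a vector_field \<Rightarrow> 'a vector_field) \<Rightarrow>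
   'a vector_field \<Rightarrow> 'a vector_field \<Rightarrow> 'a vector_field \<Rightarrow> 'a vector_field" where
  "cov_mult D X Y Z = D X (Y \<star> Z) - D X Y \<star> Z - Y \<star> D X Z"

text \<open>Total symmetry is invariance under the two generating transpositions.\<close>

definition compatible :: "('a vector_field \<Rightarrow> 'a vector_field \<Rightarrow> 'a vector_field) \<Rightarrow> bool" where
  "compatible D \<longleftrightarrow>
     (\<forall>X\<in>vector_fields. \<forall>Y\<in>vector_fields. \<forall>Z\<in>vector_fields.
        cov_mult D X Y Z = cov_mult D Y X Z \<and> cov_mult D X Y Z = cov_mult D X Z Y)"

definition shift_connection ::
  "('a vector_field \<Rightarrow> 'a vector_field \<Rightarrow> 'a vector_field) \<Rightarrow> 'a vector_field \<Rightarrow>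
   'a vector_field \<Rightarrow> 'a vector_field \<Rightarrow> 'a vector_field" where
  "shift_connection D V X Y =
     (if X \<in> vector_fields \<and> Y \<in> vector_fields then D X Y + V \<star> X \<star> Y else 0)"

definition special_family ::
  "('a vector_field \<Rightarrow> 'a vector_field \<Rightarrow> 'a vector_field) set \<Rightarrow> bool" where
  "special_family S \<longleftrightarrow>
     (\<exists>D. connection D \<and> torsion_free D \<and> compatible D \<and>
          S = {shift_connection D V | V. V \<in> vector_fields})"

definition curvature_condition ::
  "('a vector_field \<Rightarrow> 'a vector_field \<Rightarrow> 'a vector_field) \<Rightarrow> bool" where
  "curvature_condition D \<longleftrightarrow>
     (\<forall>X\<in>vector_fields. \<forall>Y\<in>vector_fields. \<forall>Z\<in>vector_fields. \<forall>V\<in>vector_fields.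
        V \<star> curvature D Z Y X + Y \<star> curvature D V Z X + Z \<star> curvature D Y V X = 0)"

definition legendre_field ::
  "('a vector_field \<Rightarrow> 'a vector_field \<Rightarrow> 'a vector_field) set \<Rightarrow> 'a vector_field \<Rightarrow> bool" where
  "legendre_field S u \<longleftrightarrow>
     invertible_field u \<and>
     (\<exists>D\<in>S. \<forall>X\<in>vector_fields. \<forall>Y\<in>vector_fields. D X u \<star> Y = D Y u \<star> X)"

definition legendre_connection ::
  "'a vector_field \<Rightarrow> ('a vector_field \<Rightarrow> 'a vector_field \<Rightarrow> 'a vector_field) \<Rightarrow>
   'a vector_field \<Rightarrow> 'a vector_field \<Rightarrow> 'a vector_field" where
  "legendre_connection u D X Y =
     (if X \<in> vector_fields \<and> Y \<in> vector_fields then inverse_field u \<star> D X (u \<star> Y) else 0)"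

definition legendre_transform ::
  "'a vector_field \<Rightarrow> ('a vector_field \<Rightarrow> 'a vector_field \<Rightarrow> 'a vector_field) set \<Rightarrow>
   ('a vector_field \<Rightarrow> 'a vector_field \<Rightarrow> 'a vector_field) set" where
  "legendre_transform u S = legendre_connection u ` S"

end


section \<open>F-manifolds\<close>

locale F_manifold = tangent_multiplication M A mult e
  for M :: "'a topology" and A :: "('a set \<times> ('a \<Rightarrow> 'b::euclidean_space)) set"
    and mult :: "'a \<Rightarrow> 'a tangent_vector \<Rightarrow> 'a tangent_vector \<Rightarrow> 'a tangent_vector"
    and e :: "'a vector_field" +
  assumes F_manifold_condition:
    "X \<in> vector_fields \<Longrightarrow> Y \<in> vector_fields \<Longrightarrow> Z \<in> vector_fields \<Longrightarrow> W \<in> vector_fields \<Longrightarrow>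
      lie_mult (X \<star> Y) Z W = X \<star> lie_mult Y Z W + Y \<star> lie_mult X Z W"

end

(*
  Write T(X,Y,Z) for the covariant derivative of the multiplication in the direction X. Expanding
  T(u,X,YZ) - Y T(u,X,Z) gives an expression symmetric in X and Y; with the total symmetry of T
  this is all that is needed. Applied to the Legendre field u it makes the transformed connection
  compatible. Applied to a shift V it shows that shifting a connection changes its
  curvature R_{X,Y}Z by Y A(X) - X A(Y) with A(X) = T(V,X,Z) + (D_X V) Z, which drops out of the
  cyclic sum. The transformed connection is conjugate to the original one by multiplication
  with u, hence so is its curvature.
*)
theory Submission
  imports Defs
begin

text \<open>Brings \<open>cov_mult_product_symmetric\<close> into the form in which it enters the
  curvature of a shifted connection.\<close>

lemma diff_eq_diff_exchange:
  fixes a b c d :: "'a::ab_group_add"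
  assumes "a - b = c - d"
  shows "a - c = b - d"
  using assms by (simp add: algebra_simps)

section \<open>Sums and products of maps of class C^k on an open set\<close>

lemma Ck_on_cong:
  assumes "open S" "\<And>x. x \<in> S \<Longrightarrow> f x = g x" "Ck_on k f S"
  shows "Ck_on k g S"
  using assms(2,3)
proof (induction k arbitrary: f g)
  case 0
  then show ?case by (simp cong: continuous_on_cong)
next
  case (Suc k)
  \<comment> \<open>As \<open>S\<close> is open, \<open>f\<close> and \<open>g\<close> agree near
    \<open>x\<close>, so the derivative of \<open>f\<close> at \<open>x\<close> is also that of
    \<open>g\<close>.\<close>
  have der: "(g has_derivative frechet_derivative f (at x)) (at x)" if "x \<in> S" for x
  proof -
    have "(f has_derivative frechet_derivative f (at x)) (at x)"
      using Suc.prems(2) that by (simp add: frechet_derivative_works)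
    then show ?thesis
      by (rule has_derivative_transform_within_open[OF _ assms(1) that]) (simp add: Suc.prems(1))
  qed
  have "Ck_on k (\<lambda>x. frechet_derivative g (at x) v) S" for v
  proof (rule Suc.IH)
    show "frechet_derivative f (at x) v = frechet_derivative g (at x) v" if "x \<in> S" for x
      using frechet_derivative_at[OF der[OF that]] by simp
    show "Ck_on k (\<lambda>x. frechet_derivative f (at x) v) S"
      using Suc.prems(2) by simp
  qed
  with der show ?case by (auto simp: differentiable_def)
qed

lemma Ck_on_const: "Ck_on k (\<lambda>x. c) S"
  by (induction k arbitrary: c) auto

text \<open>Differentiability gives continuity at the bottom; above it, the induction hypothesis is
  applied to the directional derivatives. The product rule needs this, since it leaves one factor
  undifferentiated.\<close>

lemma Ck_on_SucD: "Ck_on (Suc k) f S \<Longrightarrow> Ck_on k f S"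
proof (induction k arbitrary: f)
  case 0
  then show ?case
    by (simp add: continuous_at_imp_continuous_on differentiable_imp_continuous_within)
next
  case (Suc k)
  have "Ck_on k (\<lambda>x. frechet_derivative f (at x) v) S" for v
    using Suc.IH Suc.prems by (metis Ck_on.simps(2))
  then show ?case using Suc.prems by simp
qed

lemma Ck_on_add:
  assumes "open S" "Ck_on k f S" "Ck_on k g S"
  shows "Ck_on k (\<lambda>x. f x + g x) S"
  using assms(2,3)
proof (induction k arbitrary: f g)
  case 0
  then show ?case by (simp add: continuous_on_add)
next
  case (Suc k)
  have der: "((\<lambda>x. f x + g x) has_derivative
      (\<lambda>v. frechet_derivative f (at x) v + frechet_derivative g (at x) v)) (at x)"
    if "x \<in> S" for x
    using Suc.prems that by (intro has_derivative_add) (simp_all add: frechet_derivative_works)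
  have "Ck_on k (\<lambda>x. frechet_derivative (\<lambda>x. f x + g x) (at x) v) S" for v
  \<comment> \<open>The formula for the derivative of the sum is known only at points of
    \<open>S\<close>, hence the passage through congruence on \<open>S\<close>.\<close>
  proof (rule Ck_on_cong[OF assms(1)])
    show "Ck_on k (\<lambda>x. frechet_derivative f (at x) v + frechet_derivative g (at x) v) S"
      using Suc by simp
    show "frechet_derivative f (at x) v + frechet_derivative g (at x) v
        = frechet_derivative (\<lambda>x. f x + g x) (at x) v" if "x \<in> S" for x
      using frechet_derivative_at[OF der[OF that]] by metis
  qed
  with der show ?case by (auto simp: differentiable_def)
qed

lemma Ck_on_mult:
  fixes f g :: "'b::real_normed_vector \<Rightarrow> 'c::real_normed_algebra"
  assumes "open S" "Ck_on k f S" "Ck_on k g S"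
  shows "Ck_on k (\<lambda>x. f x * g x) S"
  using assms(2,3)
proof (induction k arbitrary: f g)
  case 0
  then show ?case by (simp add: continuous_on_mult)
next
  case (Suc k)
  have der: "((\<lambda>x. f x * g x) has_derivative
      (\<lambda>v. f x * frechet_derivative g (at x) v + frechet_derivative f (at x) v * g x)) (at x)"
    if "x \<in> S" for x
    using Suc.prems that by (intro has_derivative_mult) (simp_all add: frechet_derivative_works)
  have "Ck_on k (\<lambda>x. frechet_derivative (\<lambda>x. f x * g x) (at x) v) S" for v
  proof (rule Ck_on_cong[OF assms(1)])
    show "Ck_on k (\<lambda>x. f x * frechet_derivative g (at x) v + frechet_derivative f (at x) v * g x) S"
      \<comment> \<open>The induction hypothesis for products has order \<open>k\<close>; the
        undifferentiated factors have order \<open>Suc k\<close> and are lowered first.\<close>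
      using Suc.prems Ck_on_SucD by (intro Ck_on_add[OF assms(1)] Suc.IH) auto
    show "f x * frechet_derivative g (at x) v + frechet_derivative f (at x) v * g x
        = frechet_derivative (\<lambda>x. f x * g x) (at x) v" if "x \<in> S" for x
      using frechet_derivative_at[OF der[OF that]] by metis
  qed
  with der show ?case by (auto simp: differentiable_def)
qed

section \<open>Closure properties of smooth functions, tangent spaces and vector fields\<close>

context smooth_manifold
begin

lemma smooth_functionsI:
  assumes "\<And>k U \<phi>. (U, \<phi>) \<in> A \<Longrightarrow> Ck_on k (\<lambda>x. f (inv_into U \<phi> x)) (\<phi> ` U)"
    and "\<And>p. p \<notin> topspace M \<Longrightarrow> f p = 0"
  shows "f \<in> smooth_functions"
  using assms unfolding smooth_functions_def smooth_on_def comp_def by auto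

lemma smooth_functionsD:
  assumes "f \<in> smooth_functions"
  shows "(U, \<phi>) \<in> A \<Longrightarrow> Ck_on k (\<lambda>x. f (inv_into U \<phi> x)) (\<phi> ` U)"
    and "p \<notin> topspace M \<Longrightarrow> f p = 0"
  using assms unfolding smooth_functions_def smooth_on_def comp_def by auto

lemma smooth_functions_add:
  "f \<in> smooth_functions \<Longrightarrow> g \<in> smooth_functions \<Longrightarrow> (\<lambda>p. f p + g p) \<in> smooth_functions"
  by (intro smooth_functionsI Ck_on_add chart_image_open) (simp_all add: smooth_functionsD)

lemma smooth_functions_mult:
  "f \<in> smooth_functions \<Longrightarrow> g \<in> smooth_functions \<Longrightarrow> (\<lambda>p. f p * g p) \<in> smooth_functions"
  by (intro smooth_functionsI Ck_on_mult chart_image_open) (simp_all add: smooth_functionsD)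

lemma smooth_functions_scale:
  "f \<in> smooth_functions \<Longrightarrow> (\<lambda>p. c * f p) \<in> smooth_functions"
  by (intro smooth_functionsI Ck_on_mult Ck_on_const chart_image_open)
     (simp_all add: smooth_functionsD)

lemma smooth_functions_0: "(\<lambda>p. 0) \<in> smooth_functions"
  by (rule smooth_functionsI) (simp_all add: Ck_on_const)

lemma tangent_space_0: "0 \<in> tangent_space p"
  unfolding tangent_space_def by simp

lemma tangent_space_add:
  "v \<in> tangent_space p \<Longrightarrow> w \<in> tangent_space p \<Longrightarrow> v + w \<in> tangent_space p"
  unfolding tangent_space_def by (simp add: algebra_simps)

lemma tangent_space_scale:
  "v \<in> tangent_space p \<Longrightarrow> (\<lambda>f. c * v f) \<in> tangent_space p"
  unfolding tangent_space_def by (simp add: algebra_simps)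

lemma vector_fields_0 [simp]: "0 \<in> vector_fields"
  unfolding vector_fields_def by (simp add: tangent_space_0 smooth_functions_0)

lemma vector_fields_add [simp]:
  "X \<in> vector_fields \<Longrightarrow> Y \<in> vector_fields \<Longrightarrow> X + Y \<in> vector_fields"
  unfolding vector_fields_def by (simp add: tangent_space_add smooth_functions_add)

lemma vector_fields_scale [simp]:
  "f \<in> smooth_functions \<Longrightarrow> X \<in> vector_fields \<Longrightarrow> f \<cdot> X \<in> vector_fields"
  unfolding vector_fields_def vf_scale_def
  by (auto simp: tangent_space_scale smooth_functions_mult fun_eq_iff)

lemma vector_fields_uminus [simp]:
  assumes "X \<in> vector_fields"
  shows "- X \<in> vector_fields"
proof -
  have "(\<lambda>p. - X p f) \<in> smooth_functions" if "f \<in> smooth_functions" for f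
    using assms that smooth_functions_scale[of "\<lambda>p. X p f" "-1"]
    by (simp add: vector_fields_def)
  moreover have "- X p \<in> tangent_space p" if "p \<in> topspace M" for p
    using assms that tangent_space_scale[of "X p" p "-1"]
    by (simp add: vector_fields_def fun_Compl_def)
  ultimately show ?thesis
    using assms by (simp add: vector_fields_def fun_Compl_def zero_fun_def)
qed

lemma vector_fields_diff [simp]:
  "X \<in> vector_fields \<Longrightarrow> Y \<in> vector_fields \<Longrightarrow> X - Y \<in> vector_fields"
  using vector_fields_add[of X "- Y"] by simp

lemma vf_apply_smooth [simp]:
  "X \<in> vector_fields \<Longrightarrow> f \<in> smooth_functions \<Longrightarrow> vf_apply X f \<in> smooth_functions"
  unfolding vector_fields_def vf_apply_def by simp

lemma vector_field_tangent:
  "X \<in> vector_fields \<Longrightarrow> p \<in> topspace M \<Longrightarrow> X p \<in> tangent_space p"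
  unfolding vector_fields_def by simp

lemma vector_field_outside:
  "X \<in> vector_fields \<Longrightarrow> p \<notin> topspace M \<Longrightarrow> X p = 0"
  unfolding vector_fields_def by simp

text \<open>A torsion-free connection exhibits the bracket as a difference of two vector fields, so
  closure follows without computing with derivations.\<close>

lemma torsion_free_bracket_closed:
  assumes "connection D" "torsion_free D" "X \<in> vector_fields" "Y \<in> vector_fields"
  shows "lie_bracket X Y \<in> vector_fields"
proof -
  have "D X Y - D Y X \<in> vector_fields"
    using assms by (simp add: connection_def)
  then show ?thesis using assms by (simp add: torsion_free_def)
qed

lemma connection_closed [simp]:
  "connection D \<Longrightarrow> X \<in> vector_fields \<Longrightarrow> Y \<in> vector_fields \<Longrightarrow> D X Y \<in> vector_fields"
  by (simp add: connection_def)

lemma connection_add_right: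
  "connection D \<Longrightarrow> X \<in> vector_fields \<Longrightarrow> Y \<in> vector_fields \<Longrightarrow> Z \<in> vector_fields \<Longrightarrow>
    D X (Y + Z) = D X Y + D X Z"
  by (simp add: connection_def)

end

section \<open>The commutative algebra of vector fields\<close>

context tangent_multiplication
begin

lemma vf_mult_closed [simp]:
  "X \<in> vector_fields \<Longrightarrow> Y \<in> vector_fields \<Longrightarrow> X \<star> Y \<in> vector_fields"
  unfolding vf_mult_def by (rule mult_smooth)

text \<open>The algebraic laws are inherited fibre by fibre; off \<open>topspace M\<close> both
  sides are 0 by definition of the product.\<close>

lemma vf_mult_commute:
  "X \<in> vector_fields \<Longrightarrow> Y \<in> vector_fields \<Longrightarrow> X \<star> Y = Y \<star> X"
  unfolding vf_mult_def by (auto simp: fun_eq_iff vector_field_tangent mult_commute)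

lemma vf_mult_assoc:
  "X \<in> vector_fields \<Longrightarrow> Y \<in> vector_fields \<Longrightarrow> Z \<in> vector_fields \<Longrightarrow>
    X \<star> Y \<star> Z = X \<star> (Y \<star> Z)"
  unfolding vf_mult_def by (auto simp: fun_eq_iff vector_field_tangent mult_assoc)

lemma vf_mult_left_commute:
  "X \<in> vector_fields \<Longrightarrow> Y \<in> vector_fields \<Longrightarrow> Z \<in> vector_fields \<Longrightarrow>
    X \<star> (Y \<star> Z) = Y \<star> (X \<star> Z)"
  by (metis vf_mult_assoc vf_mult_commute)

lemma vf_mult_add_left:
  "X \<in> vector_fields \<Longrightarrow> Y \<in> vector_fields \<Longrightarrow> Z \<in> vector_fields \<Longrightarrow>
    (X + Y) \<star> Z = X \<star> Z + Y \<star> Z"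
  unfolding vf_mult_def by (auto simp: fun_eq_iff vector_field_tangent mult_add)

lemma vf_mult_add_right:
  "X \<in> vector_fields \<Longrightarrow> Y \<in> vector_fields \<Longrightarrow> Z \<in> vector_fields \<Longrightarrow>
    Z \<star> (X + Y) = Z \<star> X + Z \<star> Y"
  by (simp add: vf_mult_commute[of Z] vf_mult_add_left)

lemma vf_mult_diff_left:
  assumes "X \<in> vector_fields" "Y \<in> vector_fields" "Z \<in> vector_fields"
  shows "(X - Y) \<star> Z = X \<star> Z - Y \<star> Z"
  using vf_mult_add_left[of "X - Y" Y Z] assms by simp

lemma vf_mult_diff_right:
  "X \<in> vector_fields \<Longrightarrow> Y \<in> vector_fields \<Longrightarrow> Z \<in> vector_fields \<Longrightarrow>
    Z \<star> (X - Y) = Z \<star> X - Z \<star> Y"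
  by (simp add: vf_mult_commute[of Z] vf_mult_diff_left)

lemma vf_mult_0_right [simp]: "X \<in> vector_fields \<Longrightarrow> X \<star> 0 = 0"
  using vf_mult_diff_right[of X X X] by simp

lemma vf_mult_scale_right:
  assumes "f \<in> smooth_functions" "X \<in> vector_fields" "Y \<in> vector_fields"
  shows "X \<star> (f \<cdot> Y) = f \<cdot> (X \<star> Y)"
proof -
  have "(f \<cdot> Y) \<star> X = f \<cdot> (Y \<star> X)"
    using assms unfolding vf_mult_def vf_scale_def
    by (auto simp: fun_eq_iff vector_field_tangent mult_scale)
  then show ?thesis using assms by (simp add: vf_mult_commute)
qed

text \<open>Off \<open>topspace M\<close> the product is 0, which equals \<open>X\<close> there
  because a vector field vanishes outside the manifold.\<close>

lemma vf_mult_unit [simp]: "X \<in> vector_fields \<Longrightarrow> e \<star> X = X"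
  unfolding vf_mult_def
  by (auto simp: fun_eq_iff vector_field_tangent mult_unit vector_field_outside)

text \<open>Distributivity and ordered rewriting bring polynomial expressions in vector fields to a
  normal form. Every rule is conditional on membership in \<open>vector_fields\<close>, which is why
  later proofs declare closure facts as simplification rules.\<close>

lemmas vf_mult_simps = vf_mult_commute vf_mult_assoc vf_mult_left_commute
  vf_mult_add_left vf_mult_add_right vf_mult_diff_left vf_mult_diff_right

text \<open>Inverses in a commutative monoid are unique, so the definite description picks the
  inverse that invertibility provides.\<close>

lemma inverse_field:
  assumes "invertible_field u"
  shows "inverse_field u \<in> vector_fields" "u \<star> inverse_field u = e"
proof -
  obtain v where v: "u \<in> vector_fields" "v \<in> vector_fields" "u \<star> v = e"
    using assms unfolding invertible_field_def by blast
  have uniq: "w = v" if "w \<in> vector_fields" "u \<star> w = e" for w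
  proof -
    have "w = (u \<star> v) \<star> w" using v that by simp
    also have "\<dots> = v \<star> (u \<star> w)" using v(1,2) that(1) by (simp add: vf_mult_simps)
    also have "\<dots> = v" using v that by (simp add: vf_mult_commute[of v e] unit_field)
    finally show ?thesis .
  qed
  have "\<exists>!w. w \<in> vector_fields \<and> u \<star> w = e"
    by (rule ex1I[of _ v]) (simp add: v, elim conjE, rule uniq)
  from theI'[OF this] show "inverse_field u \<in> vector_fields" "u \<star> inverse_field u = e"
    unfolding inverse_field_def by simp_all
qed

lemma inverse_field_cancel:
  assumes "invertible_field u" "X \<in> vector_fields"
  shows "inverse_field u \<star> (u \<star> X) = X" "u \<star> (inverse_field u \<star> X) = X"
proof -
  have u: "u \<in> vector_fields" using assms(1) by (simp add: invertible_field_def)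
  note inv = inverse_field[OF assms(1)]
  have "u \<star> inverse_field u \<star> X = X" using inv assms(2) by simp
  then show "inverse_field u \<star> (u \<star> X) = X" "u \<star> (inverse_field u \<star> X) = X"
    using u inv(1) assms(2) by (simp_all add: vf_mult_assoc vf_mult_left_commute)
qed

section \<open>The covariant derivative of the multiplication\<close>

lemma cov_mult_closed [simp]:
  "connection D \<Longrightarrow> X \<in> vector_fields \<Longrightarrow> Y \<in> vector_fields \<Longrightarrow> Z \<in> vector_fields \<Longrightarrow>
    cov_mult D X Y Z \<in> vector_fields"
  by (simp add: cov_mult_def)

text \<open>The Leibniz rule with its defect, for expanding derivatives of products.\<close>

lemma connection_mult:
  "D X (Y \<star> Z) = cov_mult D X Y Z + D X Y \<star> Z + Y \<star> D X Z"
  by (simp add: cov_mult_def)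

lemma cov_mult_swap_left:
  "compatible D \<Longrightarrow> X \<in> vector_fields \<Longrightarrow> Y \<in> vector_fields \<Longrightarrow> Z \<in> vector_fields \<Longrightarrow>
    cov_mult D X Y Z = cov_mult D Y X Z"
  by (simp add: compatible_def)

text \<open>The outer transposition is a product of the two generating ones: (X,Y,Z), (Y,X,Z),
  (Y,Z,X), (Z,Y,X).\<close>

lemma cov_mult_swap_outer:
  "compatible D \<Longrightarrow> X \<in> vector_fields \<Longrightarrow> Y \<in> vector_fields \<Longrightarrow> Z \<in> vector_fields \<Longrightarrow>
    cov_mult D X Y Z = cov_mult D Z Y X"
  by (metis compatible_def)

lemma cov_mult_product_symmetric:
  assumes "connection D" "compatible D"
    and [simp]: "V \<in> vector_fields" "X \<in> vector_fields" "Y \<in> vector_fields" "Z \<in> vector_fields"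
  shows "cov_mult D X V (Y \<star> Z) - Y \<star> cov_mult D X V Z
       = cov_mult D Y V (X \<star> Z) - X \<star> cov_mult D Y V Z"
proof -
  note [simp] = connection_closed[OF assms(1)]
  \<comment> \<open>The terms with \<open>D V X\<close> cancel, and the left side becomes \<open>D V
    (X \<star> Y \<star> Z) - X \<star> D V (Y \<star> Z) - Y \<star> D V (X \<star> Z) + X \<star>
    Y \<star> D V Z\<close>, which is symmetric in \<open>X\<close> and \<open>Y\<close>.
    Compatibility then moves \<open>V\<close> to the middle slot.\<close>
  have "cov_mult D V X (Y \<star> Z) - Y \<star> cov_mult D V X Z
      = cov_mult D V Y (X \<star> Z) - X \<star> cov_mult D V Y Z"
    unfolding cov_mult_def by (simp add: vf_mult_simps algebra_simps)
  then show ?thesis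
    using assms(2) by (simp add: cov_mult_swap_left[of D _ V])
qed

section \<open>Curvature of shifted connections\<close>

lemma shift_connection_closed [simp]:
  "connection D \<Longrightarrow> V \<in> vector_fields \<Longrightarrow> X \<in> vector_fields \<Longrightarrow> Y \<in> vector_fields \<Longrightarrow>
    shift_connection D V X Y \<in> vector_fields"
  by (simp add: shift_connection_def)

lemma curvature_shift_connection:
  assumes "connection D" "torsion_free D" "compatible D"
    and [simp]: "V \<in> vector_fields" "X \<in> vector_fields" "Y \<in> vector_fields" "Z \<in> vector_fields"
  shows "curvature (shift_connection D V) X Y Z = curvature D X Y Z
      + Y \<star> (cov_mult D X V Z + D X V \<star> Z) - X \<star> (cov_mult D Y V Z + D Y V \<star> Z)"
proof -
  note [simp] = connection_closed[OF assms(1)] cov_mult_closed[OF assms(1)]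
    torsion_free_bracket_closed[OF assms(1,2)]
  have torsion: "lie_bracket X Y = D X Y - D Y X"
    using assms(2) by (simp add: torsion_free_def)
  \<comment> \<open>The Leibniz rule with defect, applied first to \<open>V\<close> and
    \<open>Q \<star> Z\<close>, then to \<open>Q\<close> and \<open>Z\<close>.\<close>
  have expand: "D P (V \<star> (Q \<star> Z)) = cov_mult D P V (Q \<star> Z) + D P V \<star> (Q \<star> Z)
      + V \<star> (cov_mult D P Q Z + D P Q \<star> Z + Q \<star> D P Z)"
    if "P \<in> vector_fields" "Q \<in> vector_fields" for P Q
    using that by (simp add: connection_mult[of D P V] connection_mult[of D P Q])
  have shift: "shift_connection D V P Q = D P Q + V \<star> P \<star> Q"
    if "P \<in> vector_fields" "Q \<in> vector_fields" for P Q
    using that by (simp add: shift_connection_def)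
  \<comment> \<open>The terms quadratic in \<open>V\<close> are symmetric in \<open>X\<close> and
    \<open>Y\<close> and cancel.\<close>
  have "curvature (shift_connection D V) X Y Z = curvature D X Y Z
      + (D X (V \<star> Y \<star> Z) + V \<star> X \<star> D Y Z - D Y (V \<star> X \<star> Z) - V \<star> Y \<star> D X Z
         - V \<star> lie_bracket X Y \<star> Z)"
    by (simp add: curvature_def shift connection_add_right[OF assms(1)] vf_mult_simps algebra_simps)
  \<comment> \<open>Vanishing torsion cancels the bracket against the terms with
    \<open>D X Y\<close> and \<open>D Y X\<close>; compatibility cancels
    \<open>V \<star> cov_mult D X Y Z\<close> against its counterpart with \<open>X\<close> and
    \<open>Y\<close> exchanged.\<close>
  moreover have "D X (V \<star> Y \<star> Z) + V \<star> X \<star> D Y Z - D Y (V \<star> X \<star> Z) - V \<star> Y \<star> D X Z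
         - V \<star> lie_bracket X Y \<star> Z
      = cov_mult D X V (Y \<star> Z) - cov_mult D Y V (X \<star> Z) + (D X V \<star> (Y \<star> Z) - D Y V \<star> (X \<star> Z))"
    by (simp add: expand torsion cov_mult_swap_left[OF assms(3), of Y X] vf_mult_simps algebra_simps)
  moreover have "cov_mult D X V (Y \<star> Z) - cov_mult D Y V (X \<star> Z)
      = Y \<star> cov_mult D X V Z - X \<star> cov_mult D Y V Z"
    by (rule diff_eq_diff_exchange) (rule cov_mult_product_symmetric[OF assms(1,3,4-7)])
  moreover have "Y \<star> cov_mult D X V Z - X \<star> cov_mult D Y V Z
        + (D X V \<star> (Y \<star> Z) - D Y V \<star> (X \<star> Z))
      = Y \<star> (cov_mult D X V Z + D X V \<star> Z) - X \<star> (cov_mult D Y V Z + D Y V \<star> Z)"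
    by (simp add: vf_mult_simps algebra_simps)
  ultimately show ?thesis
    \<comment> \<open>Regrouping all sums and differences in one way lets the four identities chain
      as rewrite rules.\<close>
    by (simp only: add_diff_eq[symmetric])
qed

text \<open>With \<open>A(P) = cov_mult D P V X + D P V \<star> X\<close>, the cyclic sum changes by
  W(Y A(Z) - Z A(Y)) + Y(Z A(W) - W A(Z)) + Z(W A(Y) - Y A(W)), where the six terms cancel in
  pairs.\<close>

lemma curvature_condition_shift_connection:
  assumes "connection D" "torsion_free D" "compatible D" and [simp]: "V \<in> vector_fields"
  shows "curvature_condition (shift_connection D V) \<longleftrightarrow> curvature_condition D"
proof -
  note [simp] = connection_closed[OF assms(1)] cov_mult_closed[OF assms(1)]
    torsion_free_bracket_closed[OF assms(1,2)]
  have closed: "curvature D X Y Z \<in> vector_fields"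
    if "X \<in> vector_fields" "Y \<in> vector_fields" "Z \<in> vector_fields" for X Y Z
    using that by (simp add: curvature_def)
  have "W \<star> curvature (shift_connection D V) Z Y X + Y \<star> curvature (shift_connection D V) W Z X
        + Z \<star> curvature (shift_connection D V) Y W X
      = W \<star> curvature D Z Y X + Y \<star> curvature D W Z X + Z \<star> curvature D Y W X"
    if [simp]: "X \<in> vector_fields" "Y \<in> vector_fields" "Z \<in> vector_fields" "W \<in> vector_fields"
    for X Y Z W
    by (simp add: curvature_shift_connection[OF assms] closed vf_mult_simps algebra_simps)
  then show ?thesis unfolding curvature_condition_def by simp
qed

section \<open>The Legendre transform of a connection\<close>

lemma legendre_connection_closed [simp]:
  "connection D \<Longrightarrow> invertible_field u \<Longrightarrow> X \<in> vector_fields \<Longrightarrow> Y \<in> vector_fields \<Longrightarrow>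
    legendre_connection u D X Y \<in> vector_fields"
  by (simp add: legendre_connection_def inverse_field invertible_field_def)

text \<open>For the Leibniz rule, \<open>f\<close> is pulled out of
  \<open>u \<star> (f \<cdot> Y)\<close>; the inverse of \<open>u\<close> then cancels
  \<open>u\<close> in the term that differentiates \<open>f\<close>.\<close>

lemma connection_legendre_connection:
  assumes D: "connection D" and u: "invertible_field u"
  shows "connection (legendre_connection u D)"
proof -
  have [simp]: "u \<in> vector_fields" using u by (simp add: invertible_field_def)
  note [simp] = inverse_field(1)[OF u] connection_closed[OF D]
    legendre_connection_closed[OF D u] inverse_field_cancel[OF u]
  have "D (X + Y) Z = D X Z + D Y Z"
    if "X \<in> vector_fields" "Y \<in> vector_fields" "Z \<in> vector_fields" for X Y Z
    using D that by (simp add: connection_def)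
  moreover have "D (f \<cdot> X) Y = f \<cdot> D X Y" "D X (f \<cdot> Y) = vf_apply X f \<cdot> Y + f \<cdot> D X Y"
    if "f \<in> smooth_functions" "X \<in> vector_fields" "Y \<in> vector_fields" for f X Y
    using D that by (simp_all add: connection_def)
  ultimately show ?thesis
    unfolding connection_def
    by (intro conjI ballI allI)
       (auto simp: legendre_connection_def vf_mult_add_right vf_mult_scale_right
         connection_add_right[OF D])
qed

text \<open>In the Leibniz rule with defect the inverse of \<open>u\<close> cancels the factor of
  \<open>u \<star> D X Y\<close>. The remaining correction carries the symmetry on which torsion and
  compatibility depend.\<close>

lemma legendre_connection_expand:
  assumes "connection D" "invertible_field u" "X \<in> vector_fields" "Y \<in> vector_fields"
  shows "legendre_connection u D X Y
      = D X Y + inverse_field u \<star> (cov_mult D X u Y + D X u \<star> Y)"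
proof -
  have [simp]: "u \<in> vector_fields" using assms(2) by (simp add: invertible_field_def)
  show ?thesis
    using assms inverse_field(1)[OF assms(2)] inverse_field_cancel[OF assms(2)]
    by (simp add: legendre_connection_def connection_mult[of D X u Y] vf_mult_add_right algebra_simps)
qed

text \<open>The correction to \<open>D X Y\<close> is symmetric in \<open>X\<close> and
  \<open>Y\<close>: its first summand by compatibility, its second by the Legendre condition. The
  torsion is therefore unchanged.\<close>

lemma torsion_free_legendre_connection:
  assumes "connection D" "invertible_field u" "torsion_free D" "compatible D"
    and sym: "\<And>X Y. X \<in> vector_fields \<Longrightarrow> Y \<in> vector_fields \<Longrightarrow> D X u \<star> Y = D Y u \<star> X"
  shows "torsion_free (legendre_connection u D)"
  unfolding torsion_free_def
proof (intro ballI)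
  fix X Y assume [simp]: "X \<in> vector_fields" "Y \<in> vector_fields"
  have [simp]: "u \<in> vector_fields" using assms(2) by (simp add: invertible_field_def)
  have "legendre_connection u D X Y - legendre_connection u D Y X = D X Y - D Y X"
    using sym[of X Y] cov_mult_swap_outer[OF assms(4), of X u Y]
    by (simp add: legendre_connection_expand[OF assms(1,2)])
  then show "legendre_connection u D X Y - legendre_connection u D Y X = lie_bracket X Y"
    using assms(3) by (simp add: torsion_free_def)
qed

lemma compatible_legendre_connection:
  assumes "connection D" "invertible_field u" "compatible D"
    and sym: "\<And>X Y. X \<in> vector_fields \<Longrightarrow> Y \<in> vector_fields \<Longrightarrow> D X u \<star> Y = D Y u \<star> X"
  shows "compatible (legendre_connection u D)"
proof -
  have [simp]: "u \<in> vector_fields" using assms(2) by (simp add: invertible_field_def)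
  note [simp] = inverse_field(1)[OF assms(2)] connection_closed[OF assms(1)]
    cov_mult_closed[OF assms(1)] legendre_connection_closed[OF assms(1,2)]
  \<comment> \<open>Of the three terms in \<open>D X u\<close>, one has positive and two have
    negative sign, so a single negative one survives.\<close>
  have cov: "cov_mult (legendre_connection u D) X Y Z = cov_mult D X Y Z + inverse_field u \<star>
      (cov_mult D X u (Y \<star> Z) - Y \<star> cov_mult D X u Z - Z \<star> cov_mult D X u Y - Z \<star> (D X u \<star> Y))"
    if [simp]: "X \<in> vector_fields" "Y \<in> vector_fields" "Z \<in> vector_fields" for X Y Z
    by (simp add: cov_mult_def[of "legendre_connection u D"] cov_mult_def[of D X Y Z]
        legendre_connection_expand[OF assms(1,2)] vf_mult_simps algebra_simps)
  show ?thesis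
    unfolding compatible_def
  proof (intro ballI conjI)
    fix X Y Z assume [simp]: "X \<in> vector_fields" "Y \<in> vector_fields" "Z \<in> vector_fields"
    show "cov_mult (legendre_connection u D) X Y Z = cov_mult (legendre_connection u D) Y X Z"
      \<comment> \<open>In the bracket of \<open>cov\<close>, the first two terms are symmetric in
        \<open>X\<close> and \<open>Y\<close> as a difference, the third by compatibility, the last
        by the Legendre condition.\<close>
      using cov_mult_product_symmetric[OF assms(1,3), of u X Y Z]
        cov_mult_swap_outer[OF assms(3), of X u Y] cov_mult_swap_left[OF assms(3), of X Y Z]
        sym[of X Y]
      by (simp add: cov)
    show "cov_mult (legendre_connection u D) X Y Z = cov_mult (legendre_connection u D) X Z Y"
      \<comment> \<open>Exchanging \<open>Y\<close> and \<open>Z\<close> permutes the two middle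
        terms of the bracket and preserves the outer ones.\<close>
      using assms(3) by (simp add: compatible_def cov vf_mult_simps algebra_simps)
  qed
qed

text \<open>Multiplication by \<open>u\<close> and by its inverse cancel in the tensorial term, so
  the shift by \<open>V\<close> survives unchanged. Hence the transforms of a special family are the
  shifts of one transformed connection.\<close>

lemma legendre_connection_shift_connection:
  assumes "connection D" "invertible_field u" "V \<in> vector_fields"
  shows "legendre_connection u (shift_connection D V)
      = shift_connection (legendre_connection u D) V"
proof (rule ext, rule ext)
  fix X Y
  have [simp]: "u \<in> vector_fields" using assms(2) by (simp add: invertible_field_def)
  note [simp] = inverse_field(1)[OF assms(2)] connection_closed[OF assms(1)] assms(3)
  show "legendre_connection u (shift_connection D V) X Y
      = shift_connection (legendre_connection u D) V X Y"
  proof (cases "X \<in> vector_fields \<and> Y \<in> vector_fields")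
    case True
    then have "inverse_field u \<star> (V \<star> X \<star> (u \<star> Y)) = V \<star> X \<star> Y"
      using inverse_field_cancel(1)[OF assms(2), of "V \<star> X \<star> Y"]
      by (simp add: vf_mult_left_commute)
    with True show ?thesis
      by (simp add: legendre_connection_def shift_connection_def vf_mult_add_right)
  next
    case False
    then show ?thesis by (auto simp: legendre_connection_def shift_connection_def)
  qed
qed

section \<open>Curvature of the transformed connection\<close>

lemma curvature_legendre_connection:
  assumes closed: "\<And>X Y. X \<in> vector_fields \<Longrightarrow> Y \<in> vector_fields \<Longrightarrow> D X Y \<in> vector_fields"
    and u: "invertible_field u"
    and [simp]: "X \<in> vector_fields" "Y \<in> vector_fields" "Z \<in> vector_fields"
      "lie_bracket X Y \<in> vector_fields"
  shows "curvature (legendre_connection u D) X Y Z = inverse_field u \<star> curvature D X Y (u \<star> Z)"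
proof -
  have [simp]: "u \<in> vector_fields" using u by (simp add: invertible_field_def)
  note [simp] = inverse_field(1)[OF u] inverse_field_cancel(2)[OF u] closed
  show ?thesis
    \<comment> \<open>Between the two successive derivatives \<open>u\<close> meets its inverse and
      cancels, leaving \<open>u\<close> innermost and the inverse outermost. Closure of
      \<open>D\<close> is the form of hypothesis that members of a special family satisfy
      directly.\<close>
    by (simp add: curvature_def legendre_connection_def vf_mult_diff_right)
qed

lemma flat_legendre_connection:
  assumes closed: "\<And>X Y. X \<in> vector_fields \<Longrightarrow> Y \<in> vector_fields \<Longrightarrow> D X Y \<in> vector_fields"
    and bracket: "\<And>X Y. X \<in> vector_fields \<Longrightarrow> Y \<in> vector_fields \<Longrightarrow>
      lie_bracket X Y \<in> vector_fields"
    and "invertible_field u" "flat D"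
  shows "flat (legendre_connection u D)"
  using assms(4) inverse_field(1)[OF assms(3)] assms(3)
  by (simp add: flat_def curvature_legendre_connection[OF closed assms(3)] bracket
      invertible_field_def)

text \<open>The inverse of \<open>u\<close> factors out of the cyclic sum, leaving the condition for
  \<open>D\<close> with \<open>u \<star> X\<close> in place of \<open>X\<close>.\<close>

lemma curvature_condition_legendre_connection:
  assumes closed: "\<And>X Y. X \<in> vector_fields \<Longrightarrow> Y \<in> vector_fields \<Longrightarrow> D X Y \<in> vector_fields"
    and bracket: "\<And>X Y. X \<in> vector_fields \<Longrightarrow> Y \<in> vector_fields \<Longrightarrow>
      lie_bracket X Y \<in> vector_fields"
    and u: "invertible_field u" and D: "curvature_condition D"
  shows "curvature_condition (legendre_connection u D)"
  unfolding curvature_condition_def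
proof (intro ballI)
  fix X Y Z V
  assume [simp]: "X \<in> vector_fields" "Y \<in> vector_fields" "Z \<in> vector_fields" "V \<in> vector_fields"
  have [simp]: "u \<in> vector_fields" using u by (simp add: invertible_field_def)
  note [simp] = inverse_field(1)[OF u] closed bracket
  have [simp]: "curvature D P Q R \<in> vector_fields"
    if "P \<in> vector_fields" "Q \<in> vector_fields" "R \<in> vector_fields" for P Q R
    using that by (simp add: curvature_def)
  have "V \<star> curvature (legendre_connection u D) Z Y X + Y \<star> curvature (legendre_connection u D) V Z X
      + Z \<star> curvature (legendre_connection u D) Y V X
    = inverse_field u \<star> (V \<star> curvature D Z Y (u \<star> X) + Y \<star> curvature D V Z (u \<star> X)
      + Z \<star> curvature D Y V (u \<star> X))"
    by (simp add: curvature_legendre_connection[OF closed u] vf_mult_left_commute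
        vf_mult_add_right)
  also have "\<dots> = 0"
    using D by (simp add: curvature_condition_def)
  finally show "V \<star> curvature (legendre_connection u D) Z Y X
      + Y \<star> curvature (legendre_connection u D) V Z X
      + Z \<star> curvature (legendre_connection u D) Y V X = 0" .
qed

section \<open>Legendre fields and special families\<close>

lemma legendre_field_symmetric:
  assumes "connection D" "legendre_field {shift_connection D V |V. V \<in> vector_fields} u"
    and [simp]: "X \<in> vector_fields" "Y \<in> vector_fields"
  shows "D X u \<star> Y = D Y u \<star> X"
proof -
  have [simp]: "u \<in> vector_fields"
    using assms(2) by (simp add: legendre_field_def invertible_field_def)
  note [simp] = connection_closed[OF assms(1)]
  obtain V where [simp]: "V \<in> vector_fields"
    and V: "\<forall>X\<in>vector_fields. \<forall>Y\<in>vector_fields.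
      shift_connection D V X u \<star> Y = shift_connection D V Y u \<star> X"
    using assms(2) unfolding legendre_field_def by blast
  \<comment> \<open>The shift contributes \<open>V \<star> X \<star> u \<star> Y\<close>, which is
    symmetric in \<open>X\<close> and \<open>Y\<close>; the condition thus passes from the given
    member of the family to the base connection.\<close>
  have "(D X u + V \<star> X \<star> u) \<star> Y = (D Y u + V \<star> Y \<star> u) \<star> X"
    using V by (simp add: shift_connection_def)
  then show ?thesis by (simp add: vf_mult_simps)
qed

lemma special_family_legendre_transform:
  assumes "special_family S" "legendre_field S u"
  shows "special_family (legendre_transform u S)"
    and "(\<exists>D\<in>S. curvature_condition D) \<longleftrightarrow> (\<forall>D\<in>S. curvature_condition D)"
    and "(\<exists>D\<in>S. curvature_condition D) \<Longrightarrow> \<forall>D\<in>legendre_transform u S. curvature_condition D"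
    and "(\<exists>D\<in>S. flat D) \<Longrightarrow> \<exists>D\<in>legendre_transform u S. flat D"
proof -
  obtain D where D: "connection D" "torsion_free D" "compatible D"
    and S: "S = {shift_connection D V |V. V \<in> vector_fields}"
    using assms(1) unfolding special_family_def by blast
  have u: "invertible_field u" using assms(2) by (simp add: legendre_field_def)
  note sym = legendre_field_symmetric[OF D(1) assms(2)[unfolded S]]
  have "legendre_transform u S
      = {shift_connection (legendre_connection u D) V |V. V \<in> vector_fields}"
    unfolding legendre_transform_def S Setcompr_eq_image image_image
    by (rule image_cong[OF refl]) (rule legendre_connection_shift_connection[OF D(1) u])
  moreover have "connection (legendre_connection u D)"
    by (rule connection_legendre_connection[OF D(1) u])
  moreover have "torsion_free (legendre_connection u D)"
    by (rule torsion_free_legendre_connection[OF D(1) u D(2,3)]) (rule sym)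
  moreover have "compatible (legendre_connection u D)"
    by (rule compatible_legendre_connection[OF D(1) u D(3)]) (rule sym)
  ultimately show "special_family (legendre_transform u S)"
    unfolding special_family_def by (intro exI[of _ "legendre_connection u D"] conjI)
  \<comment> \<open>The zero shift shows that \<open>S\<close> is nonempty, so that a condition on
    all members yields one member satisfying it.\<close>
  have "shift_connection D 0 \<in> S" using S vector_fields_0 by blast
  \<comment> \<open>Comparing each member with the base connection makes the condition independent
    of the choice.\<close>
  moreover have "curvature_condition D' \<longleftrightarrow> curvature_condition D" if "D' \<in> S" for D'
    using that S curvature_condition_shift_connection[OF D] by auto
  ultimately show all: "(\<exists>D\<in>S. curvature_condition D) \<longleftrightarrow> (\<forall>D\<in>S. curvature_condition D)"
    by blast
  have closed: "D' X Y \<in> vector_fields"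
    if "D' \<in> S" "X \<in> vector_fields" "Y \<in> vector_fields" for D' X Y
    using that S D(1) by auto
  note bracket = torsion_free_bracket_closed[OF D(1,2)]
  have "curvature_condition (legendre_connection u D')" if "D' \<in> S" "curvature_condition D'" for D'
    by (rule curvature_condition_legendre_connection[OF _ bracket u that(2)])
       (simp_all add: closed[OF that(1)])
  with all show "\<forall>D\<in>legendre_transform u S. curvature_condition D"
    if "\<exists>D\<in>S. curvature_condition D"
    using that unfolding legendre_transform_def by blast
  \<comment> \<open>The flat member of the transformed family is the transform of the flat member of
    \<open>S\<close>.\<close>
  have "flat (legendre_connection u D')" if "D' \<in> S" "flat D'" for D'
    by (rule flat_legendre_connection[OF _ bracket u that(2)]) (simp_all add: closed[OF that(1)])
  then show "\<exists>D\<in>legendre_transform u S. flat D" if "\<exists>D\<in>S. flat D"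
    using that unfolding legendre_transform_def by blast
qed

end

theorem proposition34:
  fixes M :: "'a topology"
    and A :: "('a set \<times> ('a \<Rightarrow> 'b::euclidean_space)) set"
    and mult :: "'a \<Rightarrow> 'a tangent_vector \<Rightarrow> 'a tangent_vector \<Rightarrow> 'a tangent_vector"
    and e u :: "'a vector_field"
    and S :: "('a vector_field \<Rightarrow> 'a vector_field \<Rightarrow> 'a vector_field) set"
  assumes "F_manifold M A mult e"
    and "tangent_multiplication.special_family M A mult S"
    and "tangent_multiplication.legendre_field M A mult e S u"
  shows "tangent_multiplication.special_family M A mult
           (tangent_multiplication.legendre_transform M A mult e u S) \<and>
    ((\<exists>D\<in>S. tangent_multiplication.curvature_condition M A mult D) \<longleftrightarrow>
      (\<forall>D\<in>S. tangent_multiplication.curvature_condition M A mult D)) \<and>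
    ((\<exists>D\<in>S. tangent_multiplication.curvature_condition M A mult D) \<longrightarrow>
      (\<forall>D\<in>tangent_multiplication.legendre_transform M A mult e u S.
        tangent_multiplication.curvature_condition M A mult D)) \<and>
    ((\<exists>D\<in>S. smooth_manifold.flat M A D) \<longrightarrow>
      (\<exists>D\<in>tangent_multiplication.legendre_transform M A mult e u S.
        smooth_manifold.flat M A D))"
proof -
  interpret F_manifold M A mult e by (rule assms(1))
  show ?thesis
    using special_family_legendre_transform[OF assms(2,3)] by blast
qed

end
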